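(* Let $(S_i,f_i)$, $f_i\colon S_i\to S_{i+1}$, be an inductive sequence in $\mathcal{C}$. Then $$\overline{\lim_{\rightarrow\mathcal{C}} S_i}\;=\;\lim_{\rightarrow\mathrm{Cu}}\overline{S_i},$$ i.e. the completion of the inductive limit in $\mathcal{C}$ of $(S_i,f_i)$ is (isomorphic to) the inductive limit in Cu of the induced sequence $(\overline{S_i},\overline{f_i})$ of completions.
   Context: All monoids are commutative, written additively with neutral element $0$, and equipped with a partial order $\le$ compatible with addition such that $x\ge 0$ for every element $x$. Maps between monoids are additive, order-preserving and preserve $0$. A monoid map $\varphi\colon M\to N$ is an order-embedding if $a\le b$ whenever $\varphi(a)\le\varphi(b)$. The supremum of an increasing sequence is its least upper bound, if it exists. For $x,y$ in a monoid $M$, write $x\ll y$ if, whenever $(y_n)$ is an increasing sequence in $M$ whose supremum exists in $M$ and $y\le\sup y_n$, then $x\le y_k$ for some $k$. A sequence $(x_n)$ is rapidly increasing if $x_n\ll x_{n+1}$ for all $n$. PreCu is the category whose objects are the monoids $M$ (commutative, written additively with neutral element $0$, and equipped with a partial order $\le$ compatible with addition such that $x\ge 0$ for every $x\in M$) such that (i) every element of $M$ is the supremum of a rapidly increasing sequence in $M$; (ii) $\ll$ and suprema are compatible with addition: $x\ll y$ and $z\ll t$ imply $x+z\ll y+t$, and if $(x_n)$, $(y_n)$ are increasing sequences with suprema $x$, $y$, then $x+y$ is the supremum of $(x_n+y_n)$. Maps in PreCu are monoid maps that preserve suprema of increasing sequences (when they exist) and preserve $\ll$. Cu is the full subcategory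 of PreCu consisting of the objects in which every increasing sequence has a supremum. $\mathcal{C}$ is the full subcategory of PreCu whose objects are the monoids in which every bounded (above) increasing sequence has a supremum. Both Cu and $\mathcal{C}$ have countable inductive limits, denoted $\lim_{\rightarrow\mathrm{Cu}}$ and $\lim_{\rightarrow\mathcal{C}}$. A completion of an object $M$ of PreCu is a pair $(N,\iota)$ such that (i) $N$ is an object of Cu; (ii) $\iota\colon M\to N$ is an order-embedding and a map in PreCu; (iii) for every $x\in N$ there is a rapidly increasing sequence $(x_n)$ in $M$ such that $x=\sup\iota(x_n)$. Every object $M$ of PreCu has a completion, unique up to order-isomorphism, denoted $(\overline{M},\iota_M)$. For a map $f\colon M\to N$ in PreCu, $\overline{f}\colon\overline{M}\to\overline{N}$ is the unique map in Cu with $\overline{f}\circ\iota_M=\iota_N\circ f$. *)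

theory Defs
  imports "HOL-Algebra.Group"
begin

text \<open>
  The monoids are commutative monoids in the sense of \<^theory>\<open>HOL-Algebra.Group\<close>: the library's
  multiplicative notation \<open>\<otimes>\<close>, \<open>\<one>\<close> stands for the addition and the neutral element \<open>0\<close>.
\<close>

record 'a ordered_monoid = "'a monoid" +
  leq :: "'a \<Rightarrow> 'a \<Rightarrow> bool" (infixl \<open>\<preceq>\<index>\<close> 50)

locale positively_ordered_monoid = comm_monoid M for M (structure) +
  assumes reflp_on_leq: "reflp_on (carrier M) (\<preceq>)"
    and antisymp_on_leq: "antisymp_on (carrier M) (\<preceq>)"
    and transp_on_leq: "transp_on (carrier M) (\<preceq>)"
    and leq_add: "\<lbrakk>x \<in> carrier M; y \<in> carrier M; z \<in> carrier M; x \<preceq> y\<rbrakk> \<Longrightarrow> x \<otimes> z \<preceq> y \<otimes> z"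
    and zero_leq: "x \<in> carrier M \<Longrightarrow> \<one> \<preceq> x"

definition increasing :: "'a ordered_monoid \<Rightarrow> (nat \<Rightarrow> 'a) \<Rightarrow> bool" where
  "increasing M X \<longleftrightarrow> (\<forall>n. X n \<in> carrier M) \<and> (\<forall>n. X n \<preceq>\<^bsub>M\<^esub> X (Suc n))"

definition is_supremum :: "'a ordered_monoid \<Rightarrow> (nat \<Rightarrow> 'a) \<Rightarrow> 'a \<Rightarrow> bool" where
  "is_supremum M X s \<longleftrightarrow> s \<in> carrier M \<and> (\<forall>n. X n \<preceq>\<^bsub>M\<^esub> s) \<and>
     (\<forall>u\<in>carrier M. (\<forall>n. X n \<preceq>\<^bsub>M\<^esub> u) \<longrightarrow> s \<preceq>\<^bsub>M\<^esub> u)"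

definition way_below :: "'a ordered_monoid \<Rightarrow> 'a \<Rightarrow> 'a \<Rightarrow> bool" where
  "way_below M x y \<longleftrightarrow> x \<in> carrier M \<and> y \<in> carrier M \<and>
     (\<forall>Y s. increasing M Y \<and> is_supremum M Y s \<and> y \<preceq>\<^bsub>M\<^esub> s \<longrightarrow> (\<exists>k. x \<preceq>\<^bsub>M\<^esub> Y k))"

definition rapidly_increasing :: "'a ordered_monoid \<Rightarrow> (nat \<Rightarrow> 'a) \<Rightarrow> bool" where
  "rapidly_increasing M X \<longleftrightarrow> (\<forall>n. way_below M (X n) (X (Suc n)))"

definition monoid_map :: "'a ordered_monoid \<Rightarrow> 'b ordered_monoid \<Rightarrow> ('a \<Rightarrow> 'b) \<Rightarrow> bool" where
  "monoid_map M N f \<longleftrightarrow> f \<in> hom M N \<and> f \<one>\<^bsub>M\<^esub> = \<one>\<^bsub>N\<^esub> \<and>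
     (\<forall>x\<in>carrier M. \<forall>y\<in>carrier M. x \<preceq>\<^bsub>M\<^esub> y \<longrightarrow> f x \<preceq>\<^bsub>N\<^esub> f y)"

definition order_embedding :: "'a ordered_monoid \<Rightarrow> 'b ordered_monoid \<Rightarrow> ('a \<Rightarrow> 'b) \<Rightarrow> bool" where
  "order_embedding M N f \<longleftrightarrow> monoid_map M N f \<and>
     (\<forall>x\<in>carrier M. \<forall>y\<in>carrier M. f x \<preceq>\<^bsub>N\<^esub> f y \<longrightarrow> x \<preceq>\<^bsub>M\<^esub> y)"


locale PreCu = positively_ordered_monoid M for M (structure) +
  assumes ex_rapidly_increasing:
      "x \<in> carrier M \<Longrightarrow> \<exists>X. rapidly_increasing M X \<and> is_supremum M X x"
    and way_below_add:
      "\<lbrakk>way_below M x y; way_below M z t\<rbrakk> \<Longrightarrow> way_below M (x \<otimes> z) (y \<otimes> t)"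
    and supremum_add:
      "\<lbrakk>increasing M X; is_supremum M X x; increasing M Y; is_supremum M Y y\<rbrakk>
       \<Longrightarrow> is_supremum M (\<lambda>n. X n \<otimes> Y n) (x \<otimes> y)"

definition PreCu_map :: "'a ordered_monoid \<Rightarrow> 'b ordered_monoid \<Rightarrow> ('a \<Rightarrow> 'b) \<Rightarrow> bool" where
  "PreCu_map M N f \<longleftrightarrow> monoid_map M N f \<and>
     (\<forall>X x. increasing M X \<and> is_supremum M X x \<longrightarrow> is_supremum N (\<lambda>n. f (X n)) (f x)) \<and>
     (\<forall>x y. way_below M x y \<longrightarrow> way_below N (f x) (f y))"

text \<open>\<open>Cu\<close> and \<open>C\<close> are full subcategories, so their maps are given by \<^const>\<open>PreCu_map\<close>.\<close>

locale Cu = PreCu M for M (structure) +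
  assumes increasing_has_supremum: "increasing M X \<Longrightarrow> \<exists>s. is_supremum M X s"

locale C_object = PreCu M for M (structure) +
  assumes bounded_increasing_has_supremum:
    "\<lbrakk>increasing M X; u \<in> carrier M; \<forall>n. X n \<preceq> u\<rbrakk> \<Longrightarrow> \<exists>s. is_supremum M X s"

definition PreCu_isomorphism :: "'a ordered_monoid \<Rightarrow> 'b ordered_monoid \<Rightarrow> ('a \<Rightarrow> 'b) \<Rightarrow> bool" where
  "PreCu_isomorphism M N f \<longleftrightarrow> PreCu_map M N f \<and>
     (\<exists>g. PreCu_map N M g \<and> (\<forall>x\<in>carrier M. g (f x) = x) \<and> (\<forall>y\<in>carrier N. f (g y) = y))"


definition cocone ::
  "(nat \<Rightarrow> 'a ordered_monoid) \<Rightarrow> (nat \<Rightarrow> 'a \<Rightarrow> 'a) \<Rightarrow> 'b ordered_monoid \<Rightarrow> (nat \<Rightarrow> 'a \<Rightarrow> 'b) \<Rightarrow> bool" where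
  "cocone S f Z \<psi> \<longleftrightarrow> (\<forall>i. PreCu_map (S i) Z (\<psi> i)) \<and>
     (\<forall>i. \<forall>x\<in>carrier (S i). \<psi> (Suc i) (f i x) = \<psi> i x)"

definition factors_uniquely ::
  "(nat \<Rightarrow> 'a ordered_monoid) \<Rightarrow> 'b ordered_monoid \<Rightarrow> (nat \<Rightarrow> 'a \<Rightarrow> 'b) \<Rightarrow>
   'z ordered_monoid \<Rightarrow> (nat \<Rightarrow> 'a \<Rightarrow> 'z) \<Rightarrow> bool" where
  "factors_uniquely S L \<phi> Z \<psi> \<longleftrightarrow>
     (\<exists>!h. h \<in> extensional (carrier L) \<and> PreCu_map L Z h \<and>
           (\<forall>i. \<forall>x\<in>carrier (S i). h (\<phi> i x) = \<psi> i x))"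

text \<open>
  HOL cannot quantify over types inside a formula, so the universal property of an inductive limit
  is relative to the type \<open>'z\<close> that carries the test objects. Being an inductive limit means
  satisfying these predicates for every \<open>'z\<close>.
\<close>

definition inductive_limit_C ::
  "'z itself \<Rightarrow> (nat \<Rightarrow> 'a ordered_monoid) \<Rightarrow> (nat \<Rightarrow> 'a \<Rightarrow> 'a) \<Rightarrow>
   'b ordered_monoid \<Rightarrow> (nat \<Rightarrow> 'a \<Rightarrow> 'b) \<Rightarrow> bool" where
  "inductive_limit_C _ S f L \<phi> \<longleftrightarrow> C_object L \<and> cocone S f L \<phi> \<and>
     (\<forall>(Z :: 'z ordered_monoid) \<psi>. C_object Z \<and> cocone S f Z \<psi> \<longrightarrow> factors_uniquely S L \<phi> Z \<psi>)"

definition inductive_limit_Cu ::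
  "'z itself \<Rightarrow> (nat \<Rightarrow> 'a ordered_monoid) \<Rightarrow> (nat \<Rightarrow> 'a \<Rightarrow> 'a) \<Rightarrow>
   'b ordered_monoid \<Rightarrow> (nat \<Rightarrow> 'a \<Rightarrow> 'b) \<Rightarrow> bool" where
  "inductive_limit_Cu _ S f L \<phi> \<longleftrightarrow> Cu L \<and> cocone S f L \<phi> \<and>
     (\<forall>(Z :: 'z ordered_monoid) \<psi>. Cu Z \<and> cocone S f Z \<psi> \<longrightarrow> factors_uniquely S L \<phi> Z \<psi>)"


definition is_completion :: "'a ordered_monoid \<Rightarrow> 'b ordered_monoid \<Rightarrow> ('a \<Rightarrow> 'b) \<Rightarrow> bool" where
  "is_completion M N \<iota> \<longleftrightarrow> Cu N \<and> order_embedding M N \<iota> \<and> PreCu_map M N \<iota> \<and>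
     (\<forall>x\<in>carrier N. \<exists>X. rapidly_increasing M X \<and> is_supremum N (\<lambda>n. \<iota> (X n)) x)"

text \<open>
  For completions \<open>(M', \<iota>)\<close> of \<open>M\<close> and \<open>(N', \<kappa>)\<close> of the codomain of \<open>f\<close>, this is the induced map
  \<open>M' \<rightarrow> N'\<close>. Extensionality only fixes its irrelevant values outside \<open>carrier M'\<close>, so that the
  description is unique.
\<close>

definition completed_map ::
  "'a ordered_monoid \<Rightarrow> 'b ordered_monoid \<Rightarrow> ('a \<Rightarrow> 'b) \<Rightarrow> 'd ordered_monoid \<Rightarrow> ('c \<Rightarrow> 'd) \<Rightarrow>
   ('a \<Rightarrow> 'c) \<Rightarrow> 'b \<Rightarrow> 'd" where
  "completed_map M M' \<iota> N' \<kappa> f =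
     (THE g. g \<in> extensional (carrier M') \<and> PreCu_map M' N' g \<and>
             (\<forall>x\<in>carrier M. g (\<iota> x) = \<kappa> (f x)))"

end

theory Submission
  imports Defs
begin

text \<open>
  A completion \<open>\<iota> : M \<rightarrow> N\<close> is a reflection: a map \<open>h\<close> from \<open>M\<close> to an object of \<open>Cu\<close> extends uniquely
  to \<open>N\<close>, by \<open>sup \<iota> x\<^sub>n \<mapsto> sup h x\<^sub>n\<close> for rapidly increasing sequences \<open>x\<^sub>n\<close>. Since \<open>Cu\<close> is a full
  subcategory of \<open>C\<close>, a cocone from the completions to an object of \<open>Cu\<close> restricts to a cocone
  from the original sequence, which factors through the limit in \<open>C\<close> and hence through its
  completion.
\<close>

section \<open>Order and way-below relation\<close>

context positively_ordered_monoid
begin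

lemma leq_refl: "x \<in> carrier M \<Longrightarrow> x \<preceq> x"
  using reflp_on_leq by (rule reflp_onD)

lemma leq_trans:
  "\<lbrakk>x \<preceq> y; y \<preceq> z; x \<in> carrier M; y \<in> carrier M; z \<in> carrier M\<rbrakk> \<Longrightarrow> x \<preceq> z"
  using transp_on_leq by (meson transp_onD)

lemma leq_antisym: "\<lbrakk>x \<preceq> y; y \<preceq> x; x \<in> carrier M; y \<in> carrier M\<rbrakk> \<Longrightarrow> x = y"
  using antisymp_on_leq by (meson antisymp_onD)

end

context PreCu
begin

lemma supremum_unique: "\<lbrakk>is_supremum M X s; is_supremum M X t\<rbrakk> \<Longrightarrow> s = t"
  unfolding is_supremum_def by (blast intro: leq_antisym)

text \<open>The definition of way-below is tested on the constant sequence \<open>y\<close>, whose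
  supremum is \<open>y\<close>.\<close>

lemma way_below_imp_leq:
  assumes "way_below M x y" shows "x \<preceq> y"
proof -
  have y: "y \<in> carrier M" using assms by (simp add: way_below_def)
  then have "increasing M (\<lambda>_. y)" "is_supremum M (\<lambda>_. y) y"
    by (auto simp: increasing_def is_supremum_def leq_refl)
  with assms y show ?thesis unfolding way_below_def by (blast intro: leq_refl)
qed

lemma rapidly_increasing_imp_increasing: "rapidly_increasing M X \<Longrightarrow> increasing M X"
  unfolding rapidly_increasing_def increasing_def
  by (meson way_below_def way_below_imp_leq)

lemma way_below_mono:
  assumes "x \<preceq> y" "way_below M y z" "z \<preceq> t" "x \<in> carrier M" "t \<in> carrier M"
  shows "way_below M x t"
  unfolding way_below_def
proof (intro conjI allI impI)
  fix Y s assume Y: "increasing M Y \<and> is_supremum M Y s \<and> t \<preceq> s"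
  then have "z \<preceq> s" using assms
    by (meson is_supremum_def leq_trans way_below_def)
  with Y assms(2) obtain k where "y \<preceq> Y k" unfolding way_below_def by blast
  then show "\<exists>k. x \<preceq> Y k" using assms Y
    by (meson increasing_def leq_trans way_below_def)
qed (use assms in auto)

end

text \<open>This makes every object of Cu a legitimate test object for the universal property of a
  limit in the larger category.\<close>

lemma (in Cu) C_object: "C_object M"
  by unfold_locales (rule increasing_has_supremum)

section \<open>Maps in PreCu and their extensional representatives\<close>

lemma PreCu_map_closed: "\<lbrakk>PreCu_map M N f; x \<in> carrier M\<rbrakk> \<Longrightarrow> f x \<in> carrier N"
  by (auto simp: PreCu_map_def monoid_map_def hom_def)

lemma PreCu_map_mono:
  "\<lbrakk>PreCu_map M N f; x \<preceq>\<^bsub>M\<^esub> y; x \<in> carrier M; y \<in> carrier M\<rbrakk> \<Longrightarrow> f x \<preceq>\<^bsub>N\<^esub> f y"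
  by (auto simp: PreCu_map_def monoid_map_def)

lemma PreCu_map_mult:
  "\<lbrakk>PreCu_map M N f; x \<in> carrier M; y \<in> carrier M\<rbrakk> \<Longrightarrow> f (x \<otimes>\<^bsub>M\<^esub> y) = f x \<otimes>\<^bsub>N\<^esub> f y"
  by (auto simp: PreCu_map_def monoid_map_def hom_def)

lemma PreCu_map_one: "PreCu_map M N f \<Longrightarrow> f \<one>\<^bsub>M\<^esub> = \<one>\<^bsub>N\<^esub>"
  by (auto simp: PreCu_map_def monoid_map_def)

lemma PreCu_map_sup:
  "\<lbrakk>PreCu_map M N f; increasing M X; is_supremum M X x\<rbrakk> \<Longrightarrow> is_supremum N (\<lambda>n. f (X n)) (f x)"
  by (auto simp: PreCu_map_def)

lemma PreCu_map_way_below: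
  "\<lbrakk>PreCu_map M N f; way_below M x y\<rbrakk> \<Longrightarrow> way_below N (f x) (f y)"
  by (auto simp: PreCu_map_def)

lemma PreCu_map_increasing:
  "\<lbrakk>PreCu_map M N f; increasing M X\<rbrakk> \<Longrightarrow> increasing N (\<lambda>n. f (X n))"
  by (auto simp: increasing_def intro: PreCu_map_mono PreCu_map_closed)

lemma PreCu_mapI:
  assumes "\<And>x. x \<in> carrier M \<Longrightarrow> f x \<in> carrier N"
    and "\<And>x y. \<lbrakk>x \<in> carrier M; y \<in> carrier M\<rbrakk> \<Longrightarrow> f (x \<otimes>\<^bsub>M\<^esub> y) = f x \<otimes>\<^bsub>N\<^esub> f y"
    and "f \<one>\<^bsub>M\<^esub> = \<one>\<^bsub>N\<^esub>"
    and "\<And>x y. \<lbrakk>x \<in> carrier M; y \<in> carrier M; x \<preceq>\<^bsub>M\<^esub> y\<rbrakk> \<Longrightarrow> f x \<preceq>\<^bsub>N\<^esub> f y"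
    and "\<And>X x. \<lbrakk>increasing M X; is_supremum M X x\<rbrakk> \<Longrightarrow> is_supremum N (\<lambda>n. f (X n)) (f x)"
    and "\<And>x y. way_below M x y \<Longrightarrow> way_below N (f x) (f y)"
  shows "PreCu_map M N f"
  using assms unfolding PreCu_map_def monoid_map_def hom_def by auto

lemma PreCu_map_comp:
  assumes "PreCu_map M N f" "PreCu_map N P g"
  shows "PreCu_map M P (\<lambda>x. g (f x))"
proof (rule PreCu_mapI)
  fix X x assume X: "increasing M X" "is_supremum M X x"
  show "is_supremum P (\<lambda>n. g (f (X n))) (g (f x))"
    by (rule PreCu_map_sup[OF assms(2) PreCu_map_increasing[OF assms(1) X(1)]
          PreCu_map_sup[OF assms(1) X]])
qed (use assms in \<open>simp_all add: PreCu_map_closed PreCu_map_mult PreCu_map_one PreCu_map_mono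
    PreCu_map_way_below\<close>)

lemma PreCu_map_id: "PreCu_map M M (\<lambda>x. x)"
  by (rule PreCu_mapI) auto

text \<open>Increasing sequences, their suprema and the way-below relation only involve elements of
  the carrier, so the values elsewhere can be normalised.\<close>

lemma PreCu_map_restrict:
  assumes "PreCu M" "PreCu_map M N f"
  shows "PreCu_map M N (restrict f (carrier M))"
proof -
  interpret PreCu M by fact
  show ?thesis
  proof (rule PreCu_mapI)
    fix X x assume X: "increasing M X" "is_supremum M X x"
    then have "x \<in> carrier M" "\<And>n. X n \<in> carrier M"
      by (auto simp: increasing_def is_supremum_def)
    with PreCu_map_sup[OF assms(2) X]
    show "is_supremum N (\<lambda>n. restrict f (carrier M) (X n)) (restrict f (carrier M) x)"
      by simp
  next
    fix x y assume xy: "way_below M x y"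
    then have "x \<in> carrier M" "y \<in> carrier M" by (auto simp: way_below_def)
    with PreCu_map_way_below[OF assms(2) xy]
    show "way_below N (restrict f (carrier M) x) (restrict f (carrier M) y)" by simp
  qed (use assms(2) in
      \<open>simp_all add: PreCu_map_closed PreCu_map_mult PreCu_map_one PreCu_map_mono\<close>)
qed

text \<open>Common shape of \<open>factors_uniquely\<close> and of the description in
  \<open>completed_map\<close>. Since \<open>P\<close> only sees values on the carrier, any map with
  \<open>P\<close> can be restricted to an extensional one, and uniqueness reduces to pointwise
  agreement on the carrier.\<close>

lemma ex1_extensional_PreCu_map:
  assumes "PreCu M" "PreCu_map M N g" "P g"
    and P_cong: "\<And>g g'. \<lbrakk>P g; \<And>x. x \<in> carrier M \<Longrightarrow> g' x = g x\<rbrakk> \<Longrightarrow> P g'"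
    and unique: "\<And>g g' x. \<lbrakk>PreCu_map M N g; P g; PreCu_map M N g'; P g'; x \<in> carrier M\<rbrakk> \<Longrightarrow> g x = g' x"
  shows "\<exists>!g. g \<in> extensional (carrier M) \<and> PreCu_map M N g \<and> P g"
proof (rule ex1I)
  show "restrict g (carrier M) \<in> extensional (carrier M) \<and>
      PreCu_map M N (restrict g (carrier M)) \<and> P (restrict g (carrier M))"
    using assms(1-3) by (auto intro: PreCu_map_restrict P_cong[of g])
next
  fix g' assume "g' \<in> extensional (carrier M) \<and> PreCu_map M N g' \<and> P g'"
  then show "g' = restrict g (carrier M)"
    using assms(2,3) unique[of g' g] by (auto simp: extensional_def)
qed

section \<open>Universal property of the completion\<close>

text \<open>Each element of \<open>N\<close> is the supremum of an increasing sequence from the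
  image of \<open>\<iota>\<close>, and both maps preserve this supremum.\<close>

lemma PreCu_map_completion_unique:
  assumes M: "PreCu M" and N: "is_completion M N \<iota>" and Z: "PreCu Z"
    and g: "PreCu_map N Z g" "PreCu_map N Z g'"
    and eq: "\<And>x. x \<in> carrier M \<Longrightarrow> g (\<iota> x) = g' (\<iota> x)"
    and x: "x \<in> carrier N"
  shows "g x = g' x"
proof -
  interpret M: PreCu M by fact
  interpret Z: PreCu Z by fact
  obtain X where X: "rapidly_increasing M X" and sup: "is_supremum N (\<lambda>n. \<iota> (X n)) x"
    using N x by (auto simp: is_completion_def)
  have incM: "increasing M X" using X by (rule M.rapidly_increasing_imp_increasing)
  then have inc: "increasing N (\<lambda>n. \<iota> (X n))"
    using N by (auto simp: is_completion_def intro: PreCu_map_increasing)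
  have "(\<lambda>n. g (\<iota> (X n))) = (\<lambda>n. g' (\<iota> (X n)))"
    using eq incM by (simp add: increasing_def)
  then show ?thesis
    using PreCu_map_sup[OF g(1) inc sup] PreCu_map_sup[OF g(2) inc sup] Z.supremum_unique by simp
qed

text \<open>The values of \<open>h\<close> along a sequence approximating \<open>x\<close> increase,
  so they have a supremum in \<open>Z\<close>. It depends only on \<open>x\<close>, because
  approximating sequences of \<open>x\<close> are mutually cofinal after \<open>\<iota>\<close>, and
  \<open>\<iota>\<close> reflects the order.\<close>

lemma PreCu_map_completion_exists:
  assumes M: "PreCu M" and N: "is_completion M N \<iota>" and Z: "Cu Z" and h: "PreCu_map M Z h"
  shows "\<exists>g. PreCu_map N Z g \<and> (\<forall>x\<in>carrier M. g (\<iota> x) = h x)"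
proof -
  interpret M: PreCu M by fact
  interpret N: Cu N using N by (simp add: is_completion_def)
  interpret Z: Cu Z by fact
  have \<iota>: "PreCu_map M N \<iota>"
    and \<iota>_embed: "\<And>x y. \<lbrakk>x \<in> carrier M; y \<in> carrier M; \<iota> x \<preceq>\<^bsub>N\<^esub> \<iota> y\<rbrakk> \<Longrightarrow> x \<preceq>\<^bsub>M\<^esub> y"
    using N by (auto simp: is_completion_def order_embedding_def)
  define approx where
    "approx X x \<longleftrightarrow> rapidly_increasing M X \<and> is_supremum N (\<lambda>n. \<iota> (X n)) x" for X x
  have approx_ex: "\<exists>X. approx X x" if "x \<in> carrier N" for x
    using N that by (auto simp: is_completion_def approx_def)
  have approx_inc: "increasing M X" if "approx X x" for X x
    using that M.rapidly_increasing_imp_increasing by (simp add: approx_def)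
  have approx_carrier: "X n \<in> carrier M" if "approx X x" for X x n
    using approx_inc[OF that] by (simp add: increasing_def)
  \<comment> \<open>Rapid increase is known in \<open>M\<close> only; it reaches \<open>N\<close>
    because \<open>\<iota>\<close> preserves way-below.\<close>
  have approx_below: "way_below N (\<iota> (X n)) x" if X: "approx X x" for X x n
  proof -
    have "way_below N (\<iota> (X n)) (\<iota> (X (Suc n)))"
      using X \<iota> by (auto simp: approx_def rapidly_increasing_def intro: PreCu_map_way_below)
    moreover have "\<iota> (X (Suc n)) \<preceq>\<^bsub>N\<^esub> x" "x \<in> carrier N"
      using X by (auto simp: approx_def is_supremum_def)
    ultimately show ?thesis
      by (meson N.leq_refl N.way_below_mono way_below_def)
  qed
  define g where "g x = (SOME s. \<exists>X. approx X x \<and> is_supremum Z (\<lambda>n. h (X n)) s)" for x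
  have ex_sup: "\<exists>s. is_supremum Z (\<lambda>n. h (X n)) s" if "approx X x" for X x
    using that approx_inc h Z.increasing_has_supremum PreCu_map_increasing by blast
  \<comment> \<open>For \<open>x = y\<close> this gives independence of the approximating sequence,
    in general it gives monotonicity of \<open>g\<close>.\<close>
  have sup_mono: "s \<preceq>\<^bsub>Z\<^esub> t"
    if X: "approx X x" "is_supremum Z (\<lambda>n. h (X n)) s"
      and Y: "approx Y y" "is_supremum Z (\<lambda>n. h (Y n)) t" and "x \<preceq>\<^bsub>N\<^esub> y" for X x Y y s t
  proof -
    have "h (X n) \<preceq>\<^bsub>Z\<^esub> t" for n
    proof -
      have "is_supremum N (\<lambda>n. \<iota> (Y n)) y" "increasing N (\<lambda>n. \<iota> (Y n))"
        using Y(1) PreCu_map_increasing[OF \<iota> approx_inc[OF Y(1)]] by (auto simp: approx_def)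
      \<comment> \<open>The term \<open>\<iota> (X n)\<close> is way below \<open>x\<close>, and
        \<open>x\<close> lies below the supremum of the \<open>\<iota> (Y k)\<close>. The embedding
        then pulls the inequality back to \<open>M\<close>, where \<open>h\<close> applies.\<close>
      then obtain k where "\<iota> (X n) \<preceq>\<^bsub>N\<^esub> \<iota> (Y k)"
        using approx_below[OF X(1), of n] \<open>x \<preceq>\<^bsub>N\<^esub> y\<close> unfolding way_below_def by blast
      then have "h (X n) \<preceq>\<^bsub>Z\<^esub> h (Y k)"
        using approx_carrier X(1) Y(1) \<iota>_embed h by (blast intro: PreCu_map_mono)
      then show ?thesis
        using Y(2) approx_carrier[OF X(1)] approx_carrier[OF Y(1)] h
        by (meson PreCu_map_closed Z.leq_trans is_supremum_def)
    qed
    then show ?thesis using X(2) Y(2) by (auto simp: is_supremum_def)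
  qed
  have g_sup: "is_supremum Z (\<lambda>n. h (X n)) (g x)" if X: "approx X x" for X x
  proof -
    obtain s where s: "is_supremum Z (\<lambda>n. h (X n)) s" using ex_sup[OF X] by blast
    then have "\<exists>s X. approx X x \<and> is_supremum Z (\<lambda>n. h (X n)) s" using X by blast
    then have "\<exists>Y. approx Y x \<and> is_supremum Z (\<lambda>n. h (Y n)) (g x)"
      unfolding g_def by (rule someI_ex)
    then obtain Y where Y: "approx Y x" "is_supremum Z (\<lambda>n. h (Y n)) (g x)" by blast
    \<comment> \<open>The choice behind \<open>g x\<close> may come from a sequence \<open>Y\<close>
      other than \<open>X\<close>; \<open>sup_mono\<close> in both directions equates the two
      suprema.\<close>
    have "x \<preceq>\<^bsub>N\<^esub> x" using X by (auto simp: approx_def is_supremum_def intro: N.leq_refl)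
    then have "g x = s"
      using sup_mono[OF X s Y] sup_mono[OF Y X s] s Y(2)
      by (auto simp: is_supremum_def intro: Z.leq_antisym)
    with s show ?thesis by simp
  qed
  have g_closed: "g x \<in> carrier Z" if "x \<in> carrier N" for x
    using approx_ex[OF that] g_sup by (auto simp: is_supremum_def)
  have g_mono: "g x \<preceq>\<^bsub>Z\<^esub> g y" if "x \<in> carrier N" "y \<in> carrier N" "x \<preceq>\<^bsub>N\<^esub> y" for x y
    using approx_ex that g_sup sup_mono by meson
  have g_\<iota>: "g (\<iota> x) = h x" if x: "x \<in> carrier M" for x
  proof -
    \<comment> \<open>A rapidly increasing sequence with supremum \<open>x\<close> inside
      \<open>M\<close> also approximates \<open>\<iota> x\<close>, and \<open>h\<close> preserves
      its supremum.\<close>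
    obtain X where X: "rapidly_increasing M X" "is_supremum M X x"
      using M.ex_rapidly_increasing[OF x] by blast
    note inc = M.rapidly_increasing_imp_increasing[OF X(1)]
    have "approx X (\<iota> x)"
      using X PreCu_map_sup[OF \<iota> inc X(2)] by (simp add: approx_def)
    from g_sup[OF this] PreCu_map_sup[OF h inc X(2)] show ?thesis by (rule Z.supremum_unique)
  qed
  have "PreCu_map N Z g"
  proof (rule PreCu_mapI)
    fix x y assume "x \<in> carrier N" "y \<in> carrier N"
    then obtain X Y where X: "approx X x" and Y: "approx Y y" using approx_ex by meson
    note XY = approx_carrier[OF X] approx_carrier[OF Y]
    \<comment> \<open>Termwise sums of approximating sequences approximate the sum, so both sides of
      additivity are suprema of one sequence in \<open>Z\<close>.\<close>
    have "is_supremum N (\<lambda>n. \<iota> (X n) \<otimes>\<^bsub>N\<^esub> \<iota> (Y n)) (x \<otimes>\<^bsub>N\<^esub> y)"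
      using X Y PreCu_map_increasing[OF \<iota> approx_inc]
      by (auto simp: approx_def intro!: N.supremum_add)
    then have "approx (\<lambda>n. X n \<otimes>\<^bsub>M\<^esub> Y n) (x \<otimes>\<^bsub>N\<^esub> y)"
      using X Y by (simp add: approx_def rapidly_increasing_def M.way_below_add
          PreCu_map_mult[OF \<iota>] XY)
    from g_sup[OF this] have "is_supremum Z (\<lambda>n. h (X n) \<otimes>\<^bsub>Z\<^esub> h (Y n)) (g (x \<otimes>\<^bsub>N\<^esub> y))"
      by (simp add: PreCu_map_mult[OF h] XY)
    moreover have "is_supremum Z (\<lambda>n. h (X n) \<otimes>\<^bsub>Z\<^esub> h (Y n)) (g x \<otimes>\<^bsub>Z\<^esub> g y)"
      using PreCu_map_increasing[OF h approx_inc] X Y g_sup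
      by (intro Z.supremum_add) auto
    ultimately show "g (x \<otimes>\<^bsub>N\<^esub> y) = g x \<otimes>\<^bsub>Z\<^esub> g y" by (rule Z.supremum_unique)
  next
    show "g \<one>\<^bsub>N\<^esub> = \<one>\<^bsub>Z\<^esub>"
      using g_\<iota>[OF M.one_closed] by (simp add: PreCu_map_one[OF \<iota>] PreCu_map_one[OF h])
  next
    fix X x assume X: "increasing N X" and x: "is_supremum N X x"
    have xN: "x \<in> carrier N" and XN: "X n \<in> carrier N" and Xx: "X n \<preceq>\<^bsub>N\<^esub> x" for n
      using X x by (auto simp: increasing_def is_supremum_def)
    obtain A where A: "approx A x" using approx_ex[OF xN] by blast
    show "is_supremum Z (\<lambda>n. g (X n)) (g x)"
      unfolding is_supremum_def
    proof (intro conjI allI ballI impI)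
      fix u assume u: "u \<in> carrier Z" "\<forall>n. g (X n) \<preceq>\<^bsub>Z\<^esub> u"
      \<comment> \<open>Each \<open>\<iota> (A n)\<close> is way below \<open>x\<close>, the
        supremum of \<open>X\<close>, and hence lies below some \<open>X k\<close>.\<close>
      have "h (A n) \<preceq>\<^bsub>Z\<^esub> u" for n
      proof -
        obtain k where "\<iota> (A n) \<preceq>\<^bsub>N\<^esub> X k"
          using approx_below[OF A, of n] X x N.leq_refl[OF xN] unfolding way_below_def by blast
        then have "g (\<iota> (A n)) \<preceq>\<^bsub>Z\<^esub> g (X k)"
          using g_mono PreCu_map_closed[OF \<iota> approx_carrier[OF A]] XN by blast
        then have "g (\<iota> (A n)) \<preceq>\<^bsub>Z\<^esub> u"
          using u g_closed XN PreCu_map_closed[OF \<iota> approx_carrier[OF A]]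
          by (meson Z.leq_trans)
        then show ?thesis by (simp add: g_\<iota> approx_carrier[OF A])
      qed
      then show "g x \<preceq>\<^bsub>Z\<^esub> u" using g_sup[OF A] u(1) by (simp add: is_supremum_def)
    qed (use g_closed g_mono xN XN Xx in auto)
  next
    fix x y assume xy: "way_below N x y"
    then have xN: "x \<in> carrier N" and yN: "y \<in> carrier N" by (auto simp: way_below_def)
    obtain Y where Y: "approx Y y" using approx_ex[OF yN] by blast
    \<comment> \<open>Two consecutive terms are interpolated: \<open>g x\<close> lies below
      \<open>h (Y k)\<close>, which is way below \<open>h (Y (Suc k))\<close>, which lies below
      \<open>g y\<close>.\<close>
    obtain k where k: "x \<preceq>\<^bsub>N\<^esub> \<iota> (Y k)"
      using xy Y PreCu_map_increasing[OF \<iota> approx_inc[OF Y]] N.leq_refl[OF yN]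
      unfolding way_below_def approx_def by blast
    have "g x \<preceq>\<^bsub>Z\<^esub> h (Y k)"
      using g_mono[OF xN _ k] PreCu_map_closed[OF \<iota> approx_carrier[OF Y]]
      by (simp add: g_\<iota> approx_carrier[OF Y])
    moreover have "way_below Z (h (Y k)) (h (Y (Suc k)))"
      using Y PreCu_map_way_below[OF h] by (simp add: approx_def rapidly_increasing_def)
    moreover have "h (Y (Suc k)) \<preceq>\<^bsub>Z\<^esub> g y"
      using g_sup[OF Y] by (simp add: is_supremum_def)
    ultimately show "way_below Z (g x) (g y)"
      using g_closed xN yN by (blast intro: Z.way_below_mono)
  qed (use g_closed g_mono in auto)
  with g_\<iota> show ?thesis by blast
qed

text \<open>The universal property makes the definite description well defined. The hypothesis on
  the composite of \<open>\<kappa>\<close> and \<open>f\<close> fits both the connecting maps and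
  the limit maps.\<close>

lemma completed_map:
  assumes M: "PreCu M" and M': "is_completion M M' \<iota>" and N': "Cu N'"
    and f: "PreCu_map M N' (\<lambda>x. \<kappa> (f x))"
  shows "PreCu_map M' N' (completed_map M M' \<iota> N' \<kappa> f)"
    and "x \<in> carrier M \<Longrightarrow> completed_map M M' \<iota> N' \<kappa> f (\<iota> x) = \<kappa> (f x)"
proof -
  interpret M': Cu M' using M' by (simp add: is_completion_def)
  interpret N': Cu N' by fact
  have \<iota>: "PreCu_map M M' \<iota>" using M' by (simp add: is_completion_def)
  obtain g where g: "PreCu_map M' N' g" "\<forall>x\<in>carrier M. g (\<iota> x) = \<kappa> (f x)"
    using PreCu_map_completion_exists[OF M M' N' f] by blast
  have "\<exists>!g. g \<in> extensional (carrier M') \<and> PreCu_map M' N' g \<and>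
      (\<forall>x\<in>carrier M. g (\<iota> x) = \<kappa> (f x))"
  proof (rule ex1_extensional_PreCu_map[where P = "\<lambda>g. \<forall>x\<in>carrier M. g (\<iota> x) = \<kappa> (f x)", OF _ g])
    show "PreCu M'" ..
  next
    fix g g' x
    assume "PreCu_map M' N' g" "\<forall>x\<in>carrier M. g (\<iota> x) = \<kappa> (f x)"
      "PreCu_map M' N' g'" "\<forall>x\<in>carrier M. g' (\<iota> x) = \<kappa> (f x)" "x \<in> carrier M'"
    then show "g x = g' x"
      using PreCu_map_completion_unique[OF M M' N'.PreCu_axioms, of g g'] by simp
  qed (simp add: PreCu_map_closed[OF \<iota>])
  from theI'[OF this, folded completed_map_def]
  show "PreCu_map M' N' (completed_map M M' \<iota> N' \<kappa> f)"
    and "x \<in> carrier M \<Longrightarrow> completed_map M M' \<iota> N' \<kappa> f (\<iota> x) = \<kappa> (f x)"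
    by auto
qed

section \<open>Factorizations through inductive limits\<close>

text \<open>Restriction to the carrier turns both maps into the one extensional factorization, which
  frees later uniqueness arguments from extensionality.\<close>

lemma factors_uniquely_eq:
  assumes L: "PreCu L" and fac: "factors_uniquely S L \<phi> Z \<psi>"
    and \<phi>: "\<And>i x. x \<in> carrier (S i) \<Longrightarrow> \<phi> i x \<in> carrier L"
    and h: "PreCu_map L Z h" "\<And>i x. x \<in> carrier (S i) \<Longrightarrow> h (\<phi> i x) = \<psi> i x"
    and h': "PreCu_map L Z h'" "\<And>i x. x \<in> carrier (S i) \<Longrightarrow> h' (\<phi> i x) = \<psi> i x"
    and x: "x \<in> carrier L"
  shows "h x = h' x"
proof -
  have "restrict k (carrier L) \<in> extensional (carrier L) \<and>
      PreCu_map L Z (restrict k (carrier L)) \<and>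
      (\<forall>i. \<forall>x\<in>carrier (S i). restrict k (carrier L) (\<phi> i x) = \<psi> i x)"
    if "PreCu_map L Z k" "\<And>i x. x \<in> carrier (S i) \<Longrightarrow> k (\<phi> i x) = \<psi> i x" for k
    using that \<phi> PreCu_map_restrict[OF L] by simp
  from this[OF h] this[OF h'] have "restrict h (carrier L) = restrict h' (carrier L)"
    using fac unfolding factors_uniquely_def by blast
  then show ?thesis using x by (metis restrict_apply')
qed

lemma cocone_closed: "\<lbrakk>cocone S f L \<phi>; x \<in> carrier (S i)\<rbrakk> \<Longrightarrow> \<phi> i x \<in> carrier L"
  by (auto simp: cocone_def intro: PreCu_map_closed)

text \<open>Each limit is tested against itself and the other one, hence the two test types
  \<open>'z\<close> and \<open>'d\<close>. The composites of the two factorizations and the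
  identities solve the same factorization problem, so they agree.\<close>

lemma inductive_limit_Cu_unique:
  fixes L :: "'d ordered_monoid" and T :: "'z ordered_monoid"
  assumes "inductive_limit_Cu TYPE('z) S f L \<phi>" "inductive_limit_Cu TYPE('d) S f L \<phi>"
    and "inductive_limit_Cu TYPE('z) S f T \<psi>" "inductive_limit_Cu TYPE('d) S f T \<psi>"
  shows "\<exists>h. PreCu_isomorphism L T h \<and> (\<forall>i. \<forall>x\<in>carrier (S i). h (\<phi> i x) = \<psi> i x)"
proof -
  interpret L: Cu L using assms(1) by (simp add: inductive_limit_Cu_def)
  interpret T: Cu T using assms(3) by (simp add: inductive_limit_Cu_def)
  have \<phi>: "cocone S f L \<phi>" and \<psi>: "cocone S f T \<psi>"
    using assms by (auto simp: inductive_limit_Cu_def)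
  have LT: "factors_uniquely S L \<phi> T \<psi>" and LL: "factors_uniquely S L \<phi> L \<phi>"
    and TL: "factors_uniquely S T \<psi> L \<phi>" and TT: "factors_uniquely S T \<psi> T \<psi>"
    using assms \<phi> \<psi> by (auto simp: inductive_limit_Cu_def)
  obtain h where h: "PreCu_map L T h" "\<And>i x. x \<in> carrier (S i) \<Longrightarrow> h (\<phi> i x) = \<psi> i x"
    using LT unfolding factors_uniquely_def by blast
  obtain k where k: "PreCu_map T L k" "\<And>i x. x \<in> carrier (S i) \<Longrightarrow> k (\<psi> i x) = \<phi> i x"
    using TL unfolding factors_uniquely_def by blast
  have "k (h x) = x" if "x \<in> carrier L" for x
    by (rule factors_uniquely_eq[OF L.PreCu_axioms LL cocone_closed[OF \<phi>]
          PreCu_map_comp[OF h(1) k(1)] _ PreCu_map_id _ that])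
      (simp_all add: h(2) k(2))
  moreover have "h (k x) = x" if "x \<in> carrier T" for x
    by (rule factors_uniquely_eq[OF T.PreCu_axioms TT cocone_closed[OF \<psi>]
          PreCu_map_comp[OF k(1) h(1)] _ PreCu_map_id _ that])
      (simp_all add: h(2) k(2))
  ultimately show ?thesis using h k unfolding PreCu_isomorphism_def by blast
qed

section \<open>Completion of the limit as limit of the completions\<close>

lemma inductive_limit_Cu_completion:
  fixes S :: "nat \<Rightarrow> 'a ordered_monoid" and S' :: "nat \<Rightarrow> 'b ordered_monoid"
    and L :: "'c ordered_monoid" and L' :: "'d ordered_monoid"
  assumes objects: "\<And>i. PreCu (S i)"
    and maps: "\<And>i. PreCu_map (S i) (S (Suc i)) (f i)"
    and completion_S: "\<And>i. is_completion (S i) (S' i) (\<iota> i)"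
    and limit: "inductive_limit_C TYPE('z) S f L \<phi>"
    and completion_L: "is_completion L L' \<kappa>"
    and f': "f' = (\<lambda>i. completed_map (S i) (S' i) (\<iota> i) (S' (Suc i)) (\<iota> (Suc i)) (f i))"
    and \<phi>': "\<phi>' = (\<lambda>i. completed_map (S i) (S' i) (\<iota> i) L' \<kappa> (\<phi> i))"
  shows "inductive_limit_Cu TYPE('z) S' f' L' \<phi>'"
proof -
  interpret L: C_object L using limit by (simp add: inductive_limit_C_def)
  interpret L': Cu L' using completion_L by (simp add: is_completion_def)
  have S'_Cu: "Cu (S' i)" and \<iota>: "PreCu_map (S i) (S' i) (\<iota> i)" for i
    using completion_S[of i] by (simp_all add: is_completion_def)
  have \<kappa>: "PreCu_map L L' \<kappa>" using completion_L by (simp add: is_completion_def)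
  have cocone: "cocone S f L \<phi>" using limit by (simp add: inductive_limit_C_def)
  then have \<phi>: "PreCu_map (S i) L (\<phi> i)" for i by (simp add: cocone_def)
  have f'_map: "PreCu_map (S' i) (S' (Suc i)) (f' i)"
    and f'_\<iota>: "x \<in> carrier (S i) \<Longrightarrow> f' i (\<iota> i x) = \<iota> (Suc i) (f i x)" for i x
    unfolding f'
    using completed_map[where \<kappa> = "\<iota> (Suc i)" and f = "f i", OF objects completion_S S'_Cu
        PreCu_map_comp[OF maps \<iota>]] by auto
  have \<phi>'_map: "PreCu_map (S' i) L' (\<phi>' i)"
    and \<phi>'_\<iota>: "x \<in> carrier (S i) \<Longrightarrow> \<phi>' i (\<iota> i x) = \<kappa> (\<phi> i x)" for i x
    unfolding \<phi>'
    using completed_map[where \<kappa> = \<kappa> and f = "\<phi> i", OF objects completion_S L'.Cu_axioms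
        PreCu_map_comp[OF \<phi> \<kappa>]] by auto
  \<comment> \<open>Two maps out of the completion \<open>S' i\<close> are compared on the image of
    \<open>\<iota> i\<close>, where the equation becomes the cocone condition for
    \<open>\<phi>\<close>.\<close>
  have "\<phi>' (Suc i) (f' i x) = \<phi>' i x" if "x \<in> carrier (S' i)" for i x
  proof (rule PreCu_map_completion_unique[OF objects completion_S L'.PreCu_axioms
        PreCu_map_comp[OF f'_map \<phi>'_map] \<phi>'_map _ that])
    fix x assume "x \<in> carrier (S i)"
    then show "\<phi>' (Suc i) (f' i (\<iota> i x)) = \<phi>' i (\<iota> i x)"
      using cocone by (simp add: f'_\<iota> \<phi>'_\<iota> PreCu_map_closed[OF maps] cocone_def)
  qed
  then have cocone': "cocone S' f' L' \<phi>'" using \<phi>'_map by (simp add: cocone_def)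
  have "factors_uniquely S' L' \<phi>' Z \<psi>"
    if Z: "Cu Z" and \<psi>: "cocone S' f' Z \<psi>" for Z :: "'z ordered_monoid" and \<psi>
  proof -
    interpret Z: Cu Z by fact
    have \<psi>_map: "PreCu_map (S' i) Z (\<psi> i)" for i using \<psi> by (simp add: cocone_def)
    \<comment> \<open>The square relating \<open>f' i\<close> and \<open>f i\<close> makes the
      restriction of \<open>\<psi>\<close> along the \<open>\<iota> i\<close> a cocone on the
      original sequence.\<close>
    have "\<psi> (Suc i) (\<iota> (Suc i) (f i x)) = \<psi> i (\<iota> i x)" if "x \<in> carrier (S i)" for i x
      using \<psi> that by (simp add: f'_\<iota>[symmetric] cocone_def PreCu_map_closed[OF \<iota>])
    then have "cocone S f Z (\<lambda>i x. \<psi> i (\<iota> i x))"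
      using PreCu_map_comp[OF \<iota> \<psi>_map] by (simp add: cocone_def)
    then have fac: "factors_uniquely S L \<phi> Z (\<lambda>i x. \<psi> i (\<iota> i x))"
      using limit Z.C_object by (simp add: inductive_limit_C_def)
    then obtain h where h: "PreCu_map L Z h"
      and h_\<phi>: "\<And>i x. x \<in> carrier (S i) \<Longrightarrow> h (\<phi> i x) = \<psi> i (\<iota> i x)"
      unfolding factors_uniquely_def by blast
    obtain h' where h': "PreCu_map L' Z h'" and h'_\<kappa>: "\<And>x. x \<in> carrier L \<Longrightarrow> h' (\<kappa> x) = h x"
      using PreCu_map_completion_exists[OF L.PreCu_axioms completion_L Z h] by blast
    have h'_\<phi>': "h' (\<phi>' i x) = \<psi> i x" if "x \<in> carrier (S' i)" for i x
      by (rule PreCu_map_completion_unique[OF objects completion_S Z.PreCu_axioms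
            PreCu_map_comp[OF \<phi>'_map h'] \<psi>_map _ that])
        (simp add: \<phi>'_\<iota> h'_\<kappa> h_\<phi> PreCu_map_closed[OF \<phi>])
    show ?thesis
      unfolding factors_uniquely_def
    proof (rule ex1_extensional_PreCu_map
        [where P = "\<lambda>h. \<forall>i. \<forall>x\<in>carrier (S' i). h (\<phi>' i x) = \<psi> i x", OF L'.PreCu_axioms h'])
      fix g g' x
      assume g: "PreCu_map L' Z g" "\<forall>i. \<forall>x\<in>carrier (S' i). g (\<phi>' i x) = \<psi> i x"
        and g': "PreCu_map L' Z g'" "\<forall>i. \<forall>x\<in>carrier (S' i). g' (\<phi>' i x) = \<psi> i x"
        and x: "x \<in> carrier L'"
      \<comment> \<open>Uniqueness is applied twice: composed with \<open>\<kappa>\<close>, both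
        maps factor the restricted cocone through \<open>L\<close>, and maps agreeing on the image
        of \<open>\<kappa>\<close> agree on \<open>L'\<close>.\<close>
      have "g (\<kappa> y) = g' (\<kappa> y)" if "y \<in> carrier L" for y
        by (rule factors_uniquely_eq[OF L.PreCu_axioms fac cocone_closed[OF cocone]
              PreCu_map_comp[OF \<kappa> g(1)] _ PreCu_map_comp[OF \<kappa> g'(1)] _ that])
          (simp_all add: \<phi>'_\<iota>[symmetric] g(2) g'(2) PreCu_map_closed[OF \<iota>])
      then show "g x = g' x"
        by (rule PreCu_map_completion_unique[OF L.PreCu_axioms completion_L Z.PreCu_axioms
              g(1) g'(1) _ x])
    qed (simp_all add: h'_\<phi>' cocone_closed[OF cocone'])
  qed
  with cocone' L'.Cu_axioms show ?thesis by (simp add: inductive_limit_Cu_def)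
qed

theorem theorem6p11:
  fixes S :: "nat \<Rightarrow> 'a ordered_monoid" and S' :: "nat \<Rightarrow> 'b ordered_monoid"
    and L :: "'c ordered_monoid" and L' :: "'d ordered_monoid"
    and f :: "nat \<Rightarrow> 'a \<Rightarrow> 'a" and \<iota> :: "nat \<Rightarrow> 'a \<Rightarrow> 'b"
    and \<phi> :: "nat \<Rightarrow> 'a \<Rightarrow> 'c" and \<kappa> :: "'c \<Rightarrow> 'd"
    and f' :: "nat \<Rightarrow> 'b \<Rightarrow> 'b" and \<phi>' :: "nat \<Rightarrow> 'b \<Rightarrow> 'd"
  assumes objects: "\<And>i. C_object (S i)"
    and maps: "\<And>i. PreCu_map (S i) (S (Suc i)) (f i)"
    and completion_S: "\<And>i. is_completion (S i) (S' i) (\<iota> i)"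
    and limit: "inductive_limit_C TYPE('z) S f L \<phi>" "inductive_limit_C TYPE('d) S f L \<phi>"
    and completion_L: "is_completion L L' \<kappa>"
    and f': "f' = (\<lambda>i. completed_map (S i) (S' i) (\<iota> i) (S' (Suc i)) (\<iota> (Suc i)) (f i))"
    and \<phi>': "\<phi>' = (\<lambda>i. completed_map (S i) (S' i) (\<iota> i) L' \<kappa> (\<phi> i))"
  shows "inductive_limit_Cu TYPE('z) S' f' L' \<phi>' \<and>
    (\<forall>(T :: 'z ordered_monoid) \<psi>.
       inductive_limit_Cu TYPE('z) S' f' T \<psi> \<and> inductive_limit_Cu TYPE('d) S' f' T \<psi> \<longrightarrow>
       (\<exists>h. PreCu_isomorphism L' T h \<and> (\<forall>i. \<forall>x\<in>carrier (S' i). h (\<phi>' i x) = \<psi> i x)))"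
proof -
  have PreCu: "PreCu (S i)" for i using objects by (rule C_object.axioms)
  \<comment> \<open>The transfer is used at both test types: \<open>'z\<close> carries the competing
    limit \<open>T\<close>, and \<open>'d\<close> carries \<open>L'\<close> itself.\<close>
  note lim = inductive_limit_Cu_completion[OF PreCu maps completion_S _ completion_L f' \<phi>']
  show ?thesis using lim[OF limit(1)] lim[OF limit(2)] inductive_limit_Cu_unique by blast
qed

end
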